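(* Let $\star$ be a semistar operation on an integral domain $D$ and let $I$ be a nonzero fractional ideal of $D$. Then $I$ is $\star_f$-invertible if and only if $I$ and $I^{-1}$ are $\star_f$-finite (hence, in particular, $\star$-finite) and $I$ is $\star$-invertible.
   Context: Let $D$ be an integral domain with quotient field $K$; $\overline{F}(D)$ is the set of nonzero $D$-submodules of $K$. A semistar operation on $D$ is a map $\star:\overline{F}(D)\to\overline{F}(D)$, $E\mapsto E^\star$, such that for all $0\ne x\in K$ and $E,F\in\overline{F}(D)$: $(xE)^\star=xE^\star$; $E\subseteq F$ implies $E^\star\subseteq F^\star$; $E\subseteq E^\star$ and $(E^\star)^\star=E^\star$. The semistar operation of finite type associated to $\star$ is $\star_f$, defined by $E^{\star_f}=\bigcup\{F^\star : F\subseteq E,\ F \text{ a nonzero finitely generated } D\text{-submodule of } K\}$. For $E,F\in\overline{F}(D)$, $(E:F)=\{z\in K: zF\subseteq E\}$, and $I^{-1}=(D:I)$. For a semistar operation $\ast$: a nonzero fractional ideal $I$ of $D$ is $\ast$-invertible if $(II^{-1})^{\ast}=D^{\ast}$; an element $E\in\overline{F}(D)$ is $\ast$-finite if there exists a nonzero finitely generated $D$-submodule $J$ of $K$ with $J^{\ast}=E^{\ast}$ (it is not required that $J\subseteq E$). *)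

theory Defs
  imports "HOL-Computational_Algebra.Computational_Algebra"
begin

text \<open>
  The integral domain D is a type of class \<^class>\<open>idom\<close>, and its quotient field K is
  the library type of fractions over it. A D-submodule of K is a subset that is a
  \<open>fract_module.subspace\<close> for the scalar multiplication below, and
  \<open>fract_module.span S\<close> is the D-submodule generated by S.
\<close>

interpretation fract_module: module "\<lambda>(a::'a::idom) (x::'a fract). to_fract a * x"
  by unfold_locales (simp_all add: algebra_simps)

definition dom_in_fract :: "'a::idom fract set" where
  "dom_in_fract = range to_fract"

definition nonzero_submodules :: "'a::idom fract set set" where
  "nonzero_submodules = {E. fract_module.subspace E \<and> E \<noteq> {0}}"

definition fg_submodule :: "'a::idom fract set \<Rightarrow> bool" where
  "fg_submodule E \<longleftrightarrow> (\<exists>S. finite S \<and> E = fract_module.span S)"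

definition fractional_ideal :: "'a::idom fract set \<Rightarrow> bool" where
  "fractional_ideal I \<longleftrightarrow>
     fract_module.subspace I \<and>
     (\<exists>d::'a. d \<noteq> 0 \<and> (\<lambda>x. to_fract d * x) ` I \<subseteq> dom_in_fract)"

definition submodule_mult :: "'a::idom fract set \<Rightarrow> 'a fract set \<Rightarrow> 'a fract set" where
  "submodule_mult E F = fract_module.span {x * y | x y. x \<in> E \<and> y \<in> F}"

definition colon :: "'a::idom fract set \<Rightarrow> 'a fract set \<Rightarrow> 'a fract set" where
  "colon E F = {z. (\<lambda>x. z * x) ` F \<subseteq> E}"

definition inverse_module :: "'a::idom fract set \<Rightarrow> 'a fract set" where
  "inverse_module I = colon dom_in_fract I"

text \<open>
  A semistar operation is represented by a total function on sets; its values outside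
  \<^const>\<open>nonzero_submodules\<close> are unconstrained and irrelevant.
\<close>

definition semistar_operation :: "('a::idom fract set \<Rightarrow> 'a fract set) \<Rightarrow> bool" where
  "semistar_operation star \<longleftrightarrow>
     star \<in> nonzero_submodules \<rightarrow> nonzero_submodules \<and>
     (\<forall>x E. x \<noteq> 0 \<longrightarrow> E \<in> nonzero_submodules \<longrightarrow>
        star ((\<lambda>y. x * y) ` E) = (\<lambda>y. x * y) ` star E) \<and>
     (\<forall>E\<in>nonzero_submodules. \<forall>F\<in>nonzero_submodules. E \<subseteq> F \<longrightarrow> star E \<subseteq> star F) \<and>
     (\<forall>E\<in>nonzero_submodules. E \<subseteq> star E \<and> star (star E) = star E)"

definition finite_type_of ::
    "('a::idom fract set \<Rightarrow> 'a fract set) \<Rightarrow> 'a fract set \<Rightarrow> 'a fract set" where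
  "finite_type_of star E =
     \<Union> {star F | F. F \<in> nonzero_submodules \<and> fg_submodule F \<and> F \<subseteq> E}"

definition star_invertible ::
    "('a::idom fract set \<Rightarrow> 'a fract set) \<Rightarrow> 'a fract set \<Rightarrow> bool" where
  "star_invertible star I \<longleftrightarrow>
     star (submodule_mult I (inverse_module I)) = star dom_in_fract"

text \<open>The finitely generated witness is not required to be contained in E.\<close>

definition star_finite ::
    "('a::idom fract set \<Rightarrow> 'a fract set) \<Rightarrow> 'a fract set \<Rightarrow> bool" where
  "star_finite star E \<longleftrightarrow>
     (\<exists>J. J \<in> nonzero_submodules \<and> fg_submodule J \<and> star J = star E)"

end

theory Submission
  imports Defs
begin

text \<open>
  Write \<open>E\<^sup>\<star>\<close> for \<open>star E\<close> and let \<open>\<star>\<^sub>f\<close> be the associated operation of finite type. The proof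
  rests on the following reading of \<open>\<star>\<^sub>f\<close>-finiteness (lemma \<open>star_finite_finite_type_iff\<close>): although
  its witness may lie outside \<open>E\<close>, the module \<open>E\<close> is \<open>\<star>\<^sub>f\<close>-finite exactly when some finitely
  generated \<open>F \<subseteq> E\<close> satisfies \<open>E \<subseteq> F\<^sup>\<star>\<close>. The reason is that each of the finitely many generators
  of a witness \<open>J \<subseteq> E\<^bsup>\<star>f\<^esup>\<close> needs only finitely many elements of \<open>E\<close>. In this form
  \<open>\<star>\<^sub>f\<close>-finiteness visibly implies \<open>\<star>\<close>-finiteness.

  Similarly, since \<open>I I\<inverse> \<subseteq> D\<close>, the ideal \<open>I\<close> is \<open>\<star>\<^sub>f\<close>-invertible exactly when \<open>1 \<in> G\<^sup>\<star>\<close> for some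
  finitely generated \<open>G \<subseteq> I I\<inverse>\<close>, and \<open>\<star>\<close>-invertible exactly when \<open>1 \<in> (I I\<inverse>)\<^sup>\<star>\<close>.

  If \<open>I\<close> is \<open>\<star>\<^sub>f\<close>-invertible, then \<open>G\<close> is contained in a product \<open>J L\<close> with \<open>J \<subseteq> I\<close> and \<open>L \<subseteq> I\<inverse>\<close>
  finitely generated. For nonzero \<open>x \<in> I\<close> one has \<open>x L \<subseteq> D\<close>, so that
  \<open>x \<in> x (J L)\<^sup>\<star> = (x J L)\<^sup>\<star> \<subseteq> J\<^sup>\<star>\<close>. Thus \<open>I \<subseteq> J\<^sup>\<star>\<close>, and symmetrically \<open>I\<inverse> \<subseteq> L\<^sup>\<star>\<close>.

  Conversely, let \<open>I \<subseteq> J\<^sup>\<star>\<close> and \<open>I\<inverse> \<subseteq> L\<^sup>\<star>\<close> with \<open>J \<subseteq> I\<close> and \<open>L \<subseteq> I\<inverse>\<close> finitely generated. Then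
  \<open>I I\<inverse> \<subseteq> J\<^sup>\<star> L\<^sup>\<star> \<subseteq> (J L)\<^sup>\<star>\<close>, so \<open>\<star>\<close>-invertibility of \<open>I\<close> gives \<open>1 \<in> (J L)\<^sup>\<star>\<close>, where \<open>J L\<close> is a
  finitely generated submodule of \<open>I I\<inverse>\<close>.
\<close>

section \<open>Submodules of the quotient field\<close>

lemma nonzero_submodulesI:
  assumes "fract_module.subspace E" "x \<in> E" "x \<noteq> 0"
  shows "E \<in> nonzero_submodules"
  using assms by (auto simp: nonzero_submodules_def)

lemma nonzero_submodulesE:
  assumes "E \<in> nonzero_submodules"
  obtains x where "fract_module.subspace E" "x \<in> E" "x \<noteq> 0"
  using assms fract_module.subspace_0 by (fastforce simp: nonzero_submodules_def)

lemma nonzero_submodules_mono: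
  assumes "E \<in> nonzero_submodules" "E \<subseteq> F" "fract_module.subspace F"
  shows "F \<in> nonzero_submodules"
  using assms by (auto elim!: nonzero_submodulesE intro: nonzero_submodulesI)

lemma nonzero_submodules_subspace:
  "E \<in> nonzero_submodules \<Longrightarrow> fract_module.subspace E"
  by (simp add: nonzero_submodules_def)

lemma subspace_vimage_mult:
  fixes c :: "'a::idom fract"
  assumes "fract_module.subspace E"
  shows "fract_module.subspace {x. c * x \<in> E}"
proof (rule fract_module.subspaceI)
  show "0 \<in> {x. c * x \<in> E}"
    using fract_module.subspace_0[OF assms] by simp
  show "x + y \<in> {x. c * x \<in> E}" if "x \<in> {x. c * x \<in> E}" "y \<in> {x. c * x \<in> E}" for x y
    using that fract_module.subspace_add[OF assms] by (simp add: distrib_left)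
  show "to_fract r * x \<in> {x. c * x \<in> E}" if "x \<in> {x. c * x \<in> E}" for r x
    using that fract_module.subspace_scale[OF assms, of "c * x" r] by (simp add: mult.left_commute)
qed

lemma subspace_image_mult:
  fixes c :: "'a::idom fract"
  assumes "fract_module.subspace E" "c \<noteq> 0"
  shows "fract_module.subspace ((\<lambda>x. c * x) ` E)"
proof -
  have "(\<lambda>x. c * x) ` E = {x. inverse c * x \<in> E}"
  proof (intro equalityI subsetI)
    fix x assume "x \<in> {x. inverse c * x \<in> E}"
    moreover have "x = c * (inverse c * x)"
      using assms(2) by (simp add: mult.assoc[symmetric])
    ultimately show "x \<in> (\<lambda>x. c * x) ` E" by blast
  qed (use assms(2) in \<open>auto simp: mult.assoc[symmetric]\<close>)
  then show ?thesis
    using subspace_vimage_mult[OF assms(1)] by simp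
qed

lemma nonzero_submodules_image_mult:
  fixes c :: "'a::idom fract"
  assumes "E \<in> nonzero_submodules" "c \<noteq> 0"
  shows "(\<lambda>x. c * x) ` E \<in> nonzero_submodules"
proof -
  obtain x where "fract_module.subspace E" "x \<in> E" "x \<noteq> 0"
    using assms(1) by (rule nonzero_submodulesE)
  then show ?thesis
    using assms(2)
    by (intro nonzero_submodulesI[of _ "c * x"] subspace_image_mult) auto
qed

lemma dom_in_fract_eq_span: "dom_in_fract = fract_module.span {1}"
  by (simp add: dom_in_fract_def fract_module.span_singleton)

lemma one_in_dom_in_fract: "1 \<in> dom_in_fract"
  by (simp add: dom_in_fract_eq_span fract_module.span_base)

lemma dom_in_fract_nonzero: "dom_in_fract \<in> nonzero_submodules"
  using one_in_dom_in_fract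
  by (intro nonzero_submodulesI[of _ 1]) (simp_all add: dom_in_fract_eq_span)

lemma fg_dom_in_fract: "fg_submodule dom_in_fract"
  unfolding fg_submodule_def dom_in_fract_eq_span by blast

lemma dom_in_fract_subset_iff:
  assumes "fract_module.subspace E"
  shows "dom_in_fract \<subseteq> E \<longleftrightarrow> 1 \<in> E"
  using one_in_dom_in_fract fract_module.span_minimal[OF _ assms, of "{1}"]
  by (auto simp: dom_in_fract_eq_span)

lemma subspace_mult_dom_in_fract:
  assumes "fract_module.subspace E" "x \<in> E" "a \<in> dom_in_fract"
  shows "a * x \<in> E"
  using assms fract_module.subspace_scale by (auto simp: dom_in_fract_def)

section \<open>Products and inverses\<close>

lemma subspace_submodule_mult: "fract_module.subspace (submodule_mult E F)"
  by (simp add: submodule_mult_def)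

lemma mult_in_submodule_mult:
  "x \<in> E \<Longrightarrow> y \<in> F \<Longrightarrow> x * y \<in> submodule_mult E F"
  unfolding submodule_mult_def by (intro fract_module.span_base) blast

lemma submodule_mult_least:
  assumes "fract_module.subspace G" "\<And>x y. x \<in> E \<Longrightarrow> y \<in> F \<Longrightarrow> x * y \<in> G"
  shows "submodule_mult E F \<subseteq> G"
  unfolding submodule_mult_def using assms by (intro fract_module.span_minimal) auto

lemma submodule_mult_mono:
  "E \<subseteq> E' \<Longrightarrow> F \<subseteq> F' \<Longrightarrow> submodule_mult E F \<subseteq> submodule_mult E' F'"
  by (intro submodule_mult_least subspace_submodule_mult) (auto intro: mult_in_submodule_mult)

lemma submodule_mult_commute: "submodule_mult E F = submodule_mult F E"
  by (intro equalityI submodule_mult_least subspace_submodule_mult)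
    (metis mult.commute mult_in_submodule_mult)+

lemma submodule_mult_nonzero:
  assumes "E \<in> nonzero_submodules" "F \<in> nonzero_submodules"
  shows "submodule_mult E F \<in> nonzero_submodules"
proof -
  obtain x y where "x \<in> E" "x \<noteq> 0" "y \<in> F" "y \<noteq> 0"
    using assms by (meson nonzero_submodulesE)
  then show ?thesis
    by (intro nonzero_submodulesI[of _ "x * y"])
      (auto intro: subspace_submodule_mult mult_in_submodule_mult)
qed

lemma submodule_mult_span:
  "submodule_mult (fract_module.span S) (fract_module.span T)
     = fract_module.span {s * t | s t. s \<in> S \<and> t \<in> T}" (is "_ = ?P")
proof (intro equalityI submodule_mult_least)
  show "?P \<subseteq> submodule_mult (fract_module.span S) (fract_module.span T)"
    by (intro fract_module.span_minimal subspace_submodule_mult)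
      (auto intro!: mult_in_submodule_mult fract_module.span_base)
  show "fract_module.subspace ?P" by simp
  have right: "s * y \<in> ?P" if "s \<in> S" "y \<in> fract_module.span T" for s y
  proof -
    have "fract_module.span T \<subseteq> {y. s * y \<in> ?P}"
      using that(1)
      by (intro fract_module.span_minimal subspace_vimage_mult)
        (auto intro: fract_module.span_base)
    with that(2) show ?thesis by blast
  qed
  show "x * y \<in> ?P" if "x \<in> fract_module.span S" "y \<in> fract_module.span T" for x y
  proof -
    have "fract_module.span S \<subseteq> {x. y * x \<in> ?P}"
      by (intro fract_module.span_minimal subspace_vimage_mult fract_module.subspace_span)
        (auto simp: mult.commute[of y] intro: right that(2))
    with that(1) show ?thesis by (auto simp: mult.commute[of x])
  qed
qed

lemma fg_submodule_mult:
  assumes "fg_submodule E" "fg_submodule F"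
  shows "fg_submodule (submodule_mult E F)"
proof -
  obtain S T where ST: "finite S" "E = fract_module.span S" "finite T" "F = fract_module.span T"
    using assms by (auto simp: fg_submodule_def)
  have "finite {s * t | s t. s \<in> S \<and> t \<in> T}"
    using ST by (intro finite_image_set2) auto
  then show ?thesis
    unfolding fg_submodule_def using ST submodule_mult_span by blast
qed

lemma finite_subset_span:
  assumes "finite S" "S \<subseteq> fract_module.span B"
  obtains T where "finite T" "T \<subseteq> B" "S \<subseteq> fract_module.span T"
proof -
  have "\<exists>t. finite t \<and> t \<subseteq> B \<and> x \<in> fract_module.span t" if "x \<in> S" for x
  proof -
    have "x \<in> fract_module.span B" using that assms(2) by blast
    then obtain t r where "finite t" "t \<subseteq> B" "x = (\<Sum>a\<in>t. to_fract (r a) * a)"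
      unfolding fract_module.span_explicit by blast
    moreover have "(\<Sum>a\<in>t. to_fract (r a) * a) \<in> fract_module.span t"
      by (intro fract_module.span_sum fract_module.span_scale fract_module.span_base)
    ultimately show ?thesis by blast
  qed
  then obtain t where t: "\<And>x. x \<in> S \<Longrightarrow> finite (t x) \<and> t x \<subseteq> B \<and> x \<in> fract_module.span (t x)"
    by metis
  show thesis
  proof
    show "finite (\<Union>x\<in>S. t x)" "(\<Union>x\<in>S. t x) \<subseteq> B" using t assms(1) by auto
    show "S \<subseteq> fract_module.span (\<Union>x\<in>S. t x)"
    proof
      fix x assume "x \<in> S"
      then show "x \<in> fract_module.span (\<Union>x\<in>S. t x)"
        using t fract_module.span_mono[of "t x" "\<Union>x\<in>S. t x"] by blast
    qed
  qed
qed

text \<open>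
  Each generator of \<open>G\<close> is a combination of finitely many products \<open>x y\<close>; the factors \<open>x\<close> and \<open>y\<close>
  that occur generate the two submodules.
\<close>

lemma fg_submodule_of_product:
  assumes "fract_module.subspace E" "fract_module.subspace F"
    and "fg_submodule G" "G \<in> nonzero_submodules" "G \<subseteq> submodule_mult E F"
  obtains J L where "fg_submodule J" "J \<in> nonzero_submodules" "J \<subseteq> E"
    and "fg_submodule L" "L \<in> nonzero_submodules" "L \<subseteq> F"
    and "G \<subseteq> submodule_mult J L"
proof -
  obtain S where S: "finite S" "G = fract_module.span S"
    using assms(3) by (auto simp: fg_submodule_def)
  have "S \<subseteq> fract_module.span {x * y | x y. x \<in> E \<and> y \<in> F}"
    using S assms(5) fract_module.span_superset[of S] unfolding submodule_mult_def by blast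
  then obtain T where T: "finite T" "T \<subseteq> {x * y | x y. x \<in> E \<and> y \<in> F}"
    "S \<subseteq> fract_module.span T"
    by (rule finite_subset_span[OF S(1)])
  have "T \<subseteq> (\<lambda>(x, y). x * y) ` (E \<times> F)" using T(2) by auto
  then obtain C where C: "finite C" "C \<subseteq> E \<times> F" "T = (\<lambda>(x, y). x * y) ` C"
    using finite_subset_image[OF T(1)] by metis
  define J L where "J = fract_module.span (fst ` C)" and "L = fract_module.span (snd ` C)"
  have "T \<subseteq> submodule_mult J L"
    unfolding C(3) J_def L_def
    by (force intro!: mult_in_submodule_mult fract_module.span_base)
  then have "fract_module.span T \<subseteq> submodule_mult J L"
    by (intro fract_module.span_minimal subspace_submodule_mult)
  then have G: "G \<subseteq> submodule_mult J L"
    using S(2) T(3) fract_module.span_minimal[of S "submodule_mult J L"] subspace_submodule_mult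
    by blast
  have nonzero: "J \<noteq> {0}" "L \<noteq> {0}"
  proof -
    have "\<not> submodule_mult J L \<subseteq> {0}"
      using G assms(4) by (elim nonzero_submodulesE) blast
    then show "J \<noteq> {0}" "L \<noteq> {0}"
      using submodule_mult_least[of "{0}" J L] by auto
  qed
  show thesis
  proof
    show "fg_submodule J" "fg_submodule L"
      using C(1) by (auto simp: J_def L_def fg_submodule_def)
    show "J \<in> nonzero_submodules" "L \<in> nonzero_submodules"
      using nonzero by (auto simp: J_def L_def nonzero_submodules_def)
    show "J \<subseteq> E" "L \<subseteq> F"
      unfolding J_def L_def using C(2) by (intro fract_module.span_minimal assms(1,2); auto)+
  qed (rule G)
qed

lemma mult_inverse_module: "x \<in> I \<Longrightarrow> y \<in> inverse_module I \<Longrightarrow> x * y \<in> dom_in_fract"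
  by (auto simp: inverse_module_def colon_def mult.commute)

lemma submodule_mult_inverse_module_subset:
  "submodule_mult I (inverse_module I) \<subseteq> dom_in_fract"
  by (intro submodule_mult_least mult_inverse_module)
    (simp_all add: dom_in_fract_eq_span)

lemma inverse_module_nonzero:
  assumes "fractional_ideal I"
  shows "inverse_module I \<in> nonzero_submodules"
proof -
  have D: "fract_module.subspace dom_in_fract" by (simp add: dom_in_fract_eq_span)
  have eq: "inverse_module I = (\<Inter>x\<in>I. {z. x * z \<in> dom_in_fract})"
    by (auto simp: inverse_module_def colon_def mult.commute)
  have "fract_module.subspace (inverse_module I)"
    unfolding eq by (intro fract_module.subspace_Inter) (auto intro: subspace_vimage_mult[OF D])
  moreover obtain d where "d \<noteq> 0" "(\<lambda>x. to_fract d * x) ` I \<subseteq> dom_in_fract"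
    using assms by (auto simp: fractional_ideal_def)
  ultimately show ?thesis
    by (intro nonzero_submodulesI[of _ "to_fract d"]) (auto simp: inverse_module_def colon_def)
qed

section \<open>Semistar operations and their finite type\<close>

locale semistar =
  fixes star :: "'a::idom fract set \<Rightarrow> 'a fract set"
  assumes semistar: "semistar_operation star"
begin

lemma star_nonzero: "E \<in> nonzero_submodules \<Longrightarrow> star E \<in> nonzero_submodules"
  using semistar by (auto simp: semistar_operation_def)

lemma star_subspace: "E \<in> nonzero_submodules \<Longrightarrow> fract_module.subspace (star E)"
  using star_nonzero nonzero_submodules_subspace by blast

lemma star_image_mult:
  "x \<noteq> 0 \<Longrightarrow> E \<in> nonzero_submodules \<Longrightarrow> star ((\<lambda>y. x * y) ` E) = (\<lambda>y. x * y) ` star E"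
  using semistar by (auto simp: semistar_operation_def)

lemma star_mono:
  "E \<in> nonzero_submodules \<Longrightarrow> F \<in> nonzero_submodules \<Longrightarrow> E \<subseteq> F \<Longrightarrow> star E \<subseteq> star F"
  using semistar by (auto simp: semistar_operation_def)

lemma star_extensive: "E \<in> nonzero_submodules \<Longrightarrow> E \<subseteq> star E"
  using semistar by (auto simp: semistar_operation_def)

lemma star_least:
  assumes "E \<in> nonzero_submodules" "F \<in> nonzero_submodules" "E \<subseteq> star F"
  shows "star E \<subseteq> star F"
  using star_mono[OF assms(1) star_nonzero assms(3)] assms(2) semistar
  by (auto simp: semistar_operation_def)

text \<open>
  Since \<open>\<star>\<close> commutes with multiplication by \<open>c \<noteq> 0\<close>, the inclusion \<open>c E \<subseteq> F\<^sup>\<star>\<close> extends to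
  \<open>c E\<^sup>\<star> = (c E)\<^sup>\<star> \<subseteq> F\<^sup>\<star>\<close>. All later estimates of products multiply by one element at a time
  in this way.
\<close>

lemma mult_star_subset:
  assumes E: "E \<in> nonzero_submodules" and F: "F \<in> nonzero_submodules"
    and c: "\<And>x. x \<in> E \<Longrightarrow> c * x \<in> star F" and y: "y \<in> star E"
  shows "c * y \<in> star F"
proof (cases "c = 0")
  case True
  then show ?thesis
    using fract_module.subspace_0[OF star_subspace[OF F]] by simp
next
  case False
  have "c * y \<in> star ((\<lambda>x. c * x) ` E)"
    using star_image_mult[OF False E] y by blast
  also have "\<dots> \<subseteq> star F"
    using c by (intro star_least nonzero_submodules_image_mult E F False) auto
  finally show ?thesis .
qed

lemma star_mult_star:
  assumes E: "E \<in> nonzero_submodules" and F: "F \<in> nonzero_submodules"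
    and x: "x \<in> star E" and y: "y \<in> star F"
  shows "x * y \<in> star (submodule_mult E F)"
proof -
  note EF = submodule_mult_nonzero[OF E F]
  have products: "a * b \<in> star (submodule_mult E F)" if "a \<in> E" "b \<in> F" for a b
    using that mult_in_submodule_mult star_extensive[OF EF] by blast
  have "a * y \<in> star (submodule_mult E F)" if "a \<in> E" for a
    using mult_star_subset[OF F EF _ y] products that by blast
  then have "y * x \<in> star (submodule_mult E F)"
    using mult_star_subset[OF E EF _ x, of y] by (simp add: mult.commute[of y])
  then show ?thesis by (simp add: mult.commute)
qed

lemma finite_type_of_iff:
  "x \<in> finite_type_of star E \<longleftrightarrow>
     (\<exists>F. F \<in> nonzero_submodules \<and> fg_submodule F \<and> F \<subseteq> E \<and> x \<in> star F)"
  by (auto simp: finite_type_of_def)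

lemma finite_type_of_mono: "E \<subseteq> F \<Longrightarrow> finite_type_of star E \<subseteq> finite_type_of star F"
  by (auto simp: finite_type_of_def)

lemma finite_type_of_fg:
  assumes "F \<in> nonzero_submodules" "fg_submodule F"
  shows "finite_type_of star F = star F"
  using assms star_mono by (auto simp: finite_type_of_def)

text \<open>
  For \<open>E\<close> nonzero, an element \<open>x\<close> of \<open>E\<close> lies in the finitely generated submodule spanned by \<open>x\<close>
  and some nonzero element of \<open>E\<close>; the latter takes care of \<open>x = 0\<close>.
\<close>

lemma finite_type_of_extensive:
  assumes "E \<in> nonzero_submodules"
  shows "E \<subseteq> finite_type_of star E"
proof
  fix x assume x: "x \<in> E"
  obtain e where e: "fract_module.subspace E" "e \<in> E" "e \<noteq> 0"
    using assms by (rule nonzero_submodulesE)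
  define F where "F = fract_module.span {x, e}"
  have "F \<in> nonzero_submodules"
    using e by (intro nonzero_submodulesI[of _ e]) (auto simp: F_def intro: fract_module.span_base)
  moreover have "fg_submodule F"
    unfolding F_def fg_submodule_def by (intro exI[of _ "{x, e}"]) simp
  moreover have "F \<subseteq> E" unfolding F_def using e x by (intro fract_module.span_minimal) auto
  moreover have "x \<in> F" by (simp add: F_def fract_module.span_base)
  ultimately show "x \<in> finite_type_of star E"
    using star_extensive finite_type_of_iff by blast
qed

text \<open>
  The elements of \<open>finite_type_of star E\<close> are covered by the modules \<open>star F\<close> with \<open>F \<subseteq> E\<close> finitely
  generated. This family is directed, so one of its members contains all generators of \<open>J\<close>.
\<close>

lemma fg_subset_finite_type_of:
  assumes E: "fract_module.subspace E"
    and J: "fg_submodule J" "J \<in> nonzero_submodules" "J \<subseteq> finite_type_of star E"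
  obtains F where "F \<in> nonzero_submodules" "fg_submodule F" "F \<subseteq> E" "J \<subseteq> star F"
proof -
  obtain S where S: "finite S" "J = fract_module.span S"
    using J(1) by (auto simp: fg_submodule_def)
  have "\<exists>T. finite T \<and> fract_module.span T \<in> nonzero_submodules \<and> T \<subseteq> E \<and>
    x \<in> star (fract_module.span T)" if "x \<in> S" for x
  proof -
    have "x \<in> finite_type_of star E"
      using J(3) that S(2) fract_module.span_superset[of S] by blast
    then obtain F where F: "F \<in> nonzero_submodules" "fg_submodule F" "F \<subseteq> E" "x \<in> star F"
      using finite_type_of_iff by blast
    then obtain T where "finite T" "F = fract_module.span T"
      by (auto simp: fg_submodule_def)
    then show ?thesis
      using F fract_module.span_superset[of T] by blast
  qed
  then obtain T where T: "\<And>x. x \<in> S \<Longrightarrow> finite (T x) \<and>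
      fract_module.span (T x) \<in> nonzero_submodules \<and> T x \<subseteq> E \<and> x \<in> star (fract_module.span (T x))"
    by metis
  define F where "F = fract_module.span (\<Union>x\<in>S. T x)"
  have T_subset: "fract_module.span (T x) \<subseteq> F" if "x \<in> S" for x
    unfolding F_def using that by (intro fract_module.span_mono) blast
  have "S \<noteq> {}"
    using J(2) S(2) by (auto simp: nonzero_submodules_def)
  then have F: "F \<in> nonzero_submodules"
    using T T_subset nonzero_submodules_mono[of _ F] F_def fract_module.subspace_span by blast
  show thesis
  proof
    show "fg_submodule F"
      unfolding F_def fg_submodule_def using S(1) T by (intro exI[of _ "\<Union>x\<in>S. T x"]) simp
    show "F \<subseteq> E"
      unfolding F_def using T E by (intro fract_module.span_minimal) auto
    have "x \<in> star F" if "x \<in> S" for x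
      using star_mono[OF _ F T_subset[OF that]] T[OF that] by blast
    then show "J \<subseteq> star F"
      unfolding S(2) by (intro fract_module.span_minimal star_subspace F) blast
  qed (rule F)
qed

text \<open>
  A witness \<open>J\<close> lies in \<open>star F\<close> for some finitely generated \<open>F \<subseteq> E\<close>, and then so does \<open>E\<close>,
  which is contained in \<open>finite_type_of star J = star J\<close>. Conversely, \<open>E \<subseteq> star F\<close> bounds every
  \<open>star G\<close> with \<open>G \<subseteq> E\<close> by \<open>star F\<close>, so that \<open>F\<close> itself is a witness.
\<close>

lemma star_finite_finite_type_iff:
  assumes E: "E \<in> nonzero_submodules"
  shows "star_finite (finite_type_of star) E \<longleftrightarrow>
    (\<exists>F. F \<in> nonzero_submodules \<and> fg_submodule F \<and> F \<subseteq> E \<and> E \<subseteq> star F)"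
proof
  assume "star_finite (finite_type_of star) E"
  then obtain J where J: "J \<in> nonzero_submodules" "fg_submodule J"
    and eq: "finite_type_of star J = finite_type_of star E"
    by (auto simp: star_finite_def)
  have star_J: "star J = finite_type_of star E"
    using eq finite_type_of_fg[OF J] by simp
  then have "J \<subseteq> finite_type_of star E"
    using star_extensive[OF J(1)] by simp
  then obtain F where F: "F \<in> nonzero_submodules" "fg_submodule F" "F \<subseteq> E" "J \<subseteq> star F"
    using fg_subset_finite_type_of[OF nonzero_submodules_subspace[OF E] J(2,1)] by blast
  have "E \<subseteq> star J"
    using finite_type_of_extensive[OF E] star_J by simp
  also have "\<dots> \<subseteq> star F"
    using star_least[OF J(1) F(1,4)] .
  finally show "\<exists>F. F \<in> nonzero_submodules \<and> fg_submodule F \<and> F \<subseteq> E \<and> E \<subseteq> star F"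
    using F by blast
next
  assume "\<exists>F. F \<in> nonzero_submodules \<and> fg_submodule F \<and> F \<subseteq> E \<and> E \<subseteq> star F"
  then obtain F where F: "F \<in> nonzero_submodules" "fg_submodule F" "F \<subseteq> E" "E \<subseteq> star F"
    by blast
  have "finite_type_of star E \<subseteq> star F"
  proof
    fix x assume "x \<in> finite_type_of star E"
    then obtain G where G: "G \<in> nonzero_submodules" "G \<subseteq> E" "x \<in> star G"
      using finite_type_of_iff by blast
    then show "x \<in> star F"
      using star_least[OF G(1) F(1)] F(4) by blast
  qed
  then have "finite_type_of star F = finite_type_of star E"
    using finite_type_of_mono[OF F(3)] finite_type_of_fg[OF F(1,2)] by blast
  then show "star_finite (finite_type_of star) E"
    using F by (auto simp: star_finite_def)
qed

lemma star_finite_finite_type_imp_star_finite: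
  assumes E: "E \<in> nonzero_submodules" and "star_finite (finite_type_of star) E"
  shows "star_finite star E"
proof -
  obtain F where F: "F \<in> nonzero_submodules" "fg_submodule F" "F \<subseteq> E" "E \<subseteq> star F"
    using assms star_finite_finite_type_iff by blast
  then have "star F = star E"
    using star_mono[OF F(1) E] star_least[OF E F(1)] by blast
  with F show ?thesis by (auto simp: star_finite_def)
qed

section \<open>Invertible ideals\<close>

text \<open>
  As \<open>I I\<inverse> \<subseteq> D\<close>, only \<open>D\<^sup>\<star> \<subseteq> (I I\<inverse>)\<^sup>\<star>\<close> is at stake, and \<open>D\<close> is generated by \<open>1\<close>.
\<close>

lemma star_invertible_iff:
  assumes "submodule_mult I (inverse_module I) \<in> nonzero_submodules" (is "?P \<in> _")
  shows "star_invertible star I \<longleftrightarrow> 1 \<in> star ?P"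
proof
  assume "star_invertible star I"
  then show "1 \<in> star ?P"
    using star_extensive[OF dom_in_fract_nonzero] one_in_dom_in_fract
    by (auto simp: star_invertible_def)
next
  assume "1 \<in> star ?P"
  then have "dom_in_fract \<subseteq> star ?P"
    using dom_in_fract_subset_iff[OF star_subspace[OF assms]] by blast
  then show "star_invertible star I"
    unfolding star_invertible_def
    using star_least[OF dom_in_fract_nonzero assms] star_mono[OF assms dom_in_fract_nonzero]
      submodule_mult_inverse_module_subset by blast
qed

lemma star_invertible_finite_type_iff:
  "star_invertible (finite_type_of star) I \<longleftrightarrow>
     (\<exists>G. G \<in> nonzero_submodules \<and> fg_submodule G \<and>
          G \<subseteq> submodule_mult I (inverse_module I) \<and> 1 \<in> star G)"
    (is "_ \<longleftrightarrow> (\<exists>G. _ \<and> _ \<and> G \<subseteq> ?P \<and> _)")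
proof -
  have star_D: "finite_type_of star dom_in_fract = star dom_in_fract"
    using finite_type_of_fg[OF dom_in_fract_nonzero fg_dom_in_fract] .
  show ?thesis
  proof
    assume "star_invertible (finite_type_of star) I"
    then have "1 \<in> finite_type_of star ?P"
      using star_D star_extensive[OF dom_in_fract_nonzero] one_in_dom_in_fract
      by (auto simp: star_invertible_def)
    then show "\<exists>G. G \<in> nonzero_submodules \<and> fg_submodule G \<and> G \<subseteq> ?P \<and> 1 \<in> star G"
      using finite_type_of_iff by blast
  next
    assume "\<exists>G. G \<in> nonzero_submodules \<and> fg_submodule G \<and> G \<subseteq> ?P \<and> 1 \<in> star G"
    then obtain G where G: "G \<in> nonzero_submodules" "fg_submodule G" "G \<subseteq> ?P" "1 \<in> star G"
      by blast
    have "dom_in_fract \<subseteq> star G"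
      using G(4) dom_in_fract_subset_iff[OF star_subspace[OF G(1)]] by blast
    then have "star dom_in_fract \<subseteq> star G"
      by (rule star_least[OF dom_in_fract_nonzero G(1)])
    also have "\<dots> \<subseteq> finite_type_of star ?P"
      using G finite_type_of_iff by blast
    finally show "star_invertible (finite_type_of star) I"
      unfolding star_invertible_def
      using finite_type_of_mono[OF submodule_mult_inverse_module_subset] star_D by blast
  qed
qed

text \<open>
  A \<open>\<star>\<close>-analogue of the dual basis argument: multiplying \<open>1 \<in> (J L)\<^sup>\<star>\<close> by \<open>x \<in> E\<close> and absorbing
  \<open>x L \<subseteq> D\<close> leaves \<open>x \<in> J\<^sup>\<star>\<close>. The hypothesis on \<open>E\<close> and \<open>L\<close> is symmetric, which allows both
  \<open>E = I\<close> and \<open>E = I\<inverse>\<close>.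
\<close>

lemma subset_star_of_one_in_star_mult:
  assumes J: "J \<in> nonzero_submodules" and L: "L \<in> nonzero_submodules"
    and one: "1 \<in> star (submodule_mult J L)"
    and EL: "\<And>x y. x \<in> E \<Longrightarrow> y \<in> L \<Longrightarrow> x * y \<in> dom_in_fract"
  shows "E \<subseteq> star J"
proof
  fix x assume x: "x \<in> E"
  have J_sub: "fract_module.subspace J" using J by (rule nonzero_submodules_subspace)
  have "submodule_mult J L \<subseteq> {z. x * z \<in> J}"
  proof (intro submodule_mult_least subspace_vimage_mult J_sub)
    fix a b assume "a \<in> J" "b \<in> L"
    then have "(x * b) * a \<in> J"
      by (intro subspace_mult_dom_in_fract[OF J_sub] EL x)
    then show "a * b \<in> {z. x * z \<in> J}" by (simp add: ac_simps)
  qed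
  then have "x * z \<in> star J" if "z \<in> submodule_mult J L" for z
    using that star_extensive[OF J] by blast
  then have "x * 1 \<in> star J"
    using mult_star_subset[OF submodule_mult_nonzero[OF J L] J _ one] by blast
  then show "x \<in> star J" by simp
qed

lemma star_invertible_finite_type_iff_star_finite:
  assumes I: "I \<in> nonzero_submodules" and inv: "inverse_module I \<in> nonzero_submodules"
  shows "star_invertible (finite_type_of star) I \<longleftrightarrow>
    star_finite (finite_type_of star) I \<and>
    star_finite (finite_type_of star) (inverse_module I) \<and>
    star_invertible star I"
proof -
  define P where "P = submodule_mult I (inverse_module I)"
  have P: "P \<in> nonzero_submodules"
    unfolding P_def by (rule submodule_mult_nonzero[OF I inv])
  note star_inv = star_invertible_iff[OF P[unfolded P_def], folded P_def]
  show ?thesis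
  proof (intro iffI conjI)
    assume "star_invertible (finite_type_of star) I"
    then obtain G where G: "G \<in> nonzero_submodules" "fg_submodule G" "G \<subseteq> P" "1 \<in> star G"
      using star_invertible_finite_type_iff P_def by blast
    show "star_invertible star I"
      using star_inv star_mono[OF G(1) P G(3)] G(4) by blast
    obtain J L where J: "fg_submodule J" "J \<in> nonzero_submodules" "J \<subseteq> I"
      and L: "fg_submodule L" "L \<in> nonzero_submodules" "L \<subseteq> inverse_module I"
      and JL: "G \<subseteq> submodule_mult J L"
      using fg_submodule_of_product[OF nonzero_submodules_subspace[OF I]
          nonzero_submodules_subspace[OF inv] G(2,1)] G(3) unfolding P_def by metis
    have one: "1 \<in> star (submodule_mult J L)"
      using star_mono[OF G(1) submodule_mult_nonzero[OF J(2) L(2)] JL] G(4) by blast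
    have "I \<subseteq> star J"
      using L(3) by (intro subset_star_of_one_in_star_mult[OF J(2) L(2) one])
        (auto intro: mult_inverse_module)
    then show "star_finite (finite_type_of star) I"
      using J star_finite_finite_type_iff[OF I] by blast
    have "y * x \<in> dom_in_fract" if "y \<in> inverse_module I" "x \<in> J" for x y
      using mult_inverse_module[of x I y] that J(3) by (auto simp: mult.commute)
    then have "inverse_module I \<subseteq> star L"
      using one by (intro subset_star_of_one_in_star_mult[OF L(2) J(2)])
        (simp_all add: submodule_mult_commute)
    then show "star_finite (finite_type_of star) (inverse_module I)"
      using L star_finite_finite_type_iff[OF inv] by blast
  next
    assume asm: "star_finite (finite_type_of star) I \<and>
      star_finite (finite_type_of star) (inverse_module I) \<and> star_invertible star I"
    obtain J where J: "J \<in> nonzero_submodules" "fg_submodule J" "J \<subseteq> I" "I \<subseteq> star J"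
      using asm star_finite_finite_type_iff[OF I] by blast
    obtain L where L: "L \<in> nonzero_submodules" "fg_submodule L" "L \<subseteq> inverse_module I"
      "inverse_module I \<subseteq> star L"
      using asm star_finite_finite_type_iff[OF inv] by blast
    note JL = submodule_mult_nonzero[OF J(1) L(1)]
    have "P \<subseteq> star (submodule_mult J L)"
      unfolding P_def using J(4) L(4)
      by (intro submodule_mult_least star_subspace JL star_mult_star J(1) L(1)) auto
    then have "1 \<in> star (submodule_mult J L)"
      using star_least[OF P JL] star_inv asm by blast
    moreover have "submodule_mult J L \<subseteq> P"
      unfolding P_def by (rule submodule_mult_mono[OF J(3) L(3)])
    ultimately show "star_invertible (finite_type_of star) I"
      using star_invertible_finite_type_iff JL fg_submodule_mult[OF J(2) L(2)] P_def by blast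
  qed
qed

end

theorem proposition2p6:
  fixes star :: "'a::idom fract set \<Rightarrow> 'a fract set"
    and I :: "'a fract set"
  assumes "semistar_operation star"
    and "fractional_ideal I" and "I \<noteq> {0}"
  shows "(star_invertible (finite_type_of star) I \<longleftrightarrow>
            star_finite (finite_type_of star) I \<and>
            star_finite (finite_type_of star) (inverse_module I) \<and>
            star_invertible star I) \<and>
         (star_finite (finite_type_of star) I \<longrightarrow> star_finite star I) \<and>
         (star_finite (finite_type_of star) (inverse_module I) \<longrightarrow>
            star_finite star (inverse_module I))"
proof -
  interpret semistar star by unfold_locales (rule assms(1))
  have I: "I \<in> nonzero_submodules"
    using assms(2,3) by (auto simp: fractional_ideal_def nonzero_submodules_def)
  have inv: "inverse_module I \<in> nonzero_submodules"
    using assms(2) by (rule inverse_module_nonzero)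
  show ?thesis
    using star_invertible_finite_type_iff_star_finite[OF I inv]
      star_finite_finite_type_imp_star_finite[OF I]
      star_finite_finite_type_imp_star_finite[OF inv] by blast
qed

end
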